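(* Let $R$ be an integral domain with integral closure $R'$ (in its quotient field). If $\tilde{I}=I$ for every nonzero finitely generated ideal $I$ of $R$, then $R'$ is a Prüfer domain.
   Context: For an integral domain $R$ and a nonzero (integral) ideal $I$ of $R$, the Ratliff-Rush closure of $I$ is the ideal $\tilde{I}=\bigcup_{n\ge 1}(I^{n+1}:_R I^n)$, where $(I^{n+1}:_R I^n)=\{x\in R : xI^n\subseteq I^{n+1}\}$. *)

theory Defs
  imports "HOL-Algebra.Polynomials" "HOL-Algebra.Ideal_Product"
begin

definition fg_ideal :: "('a, 'm) ring_scheme \<Rightarrow> 'a set \<Rightarrow> bool" where
  "fg_ideal R I \<longleftrightarrow> (\<exists>S. finite S \<and> S \<subseteq> carrier R \<and> I = Idl\<^bsub>R\<^esub> S)"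

definition colon_ideal :: "('a, 'm) ring_scheme \<Rightarrow> 'a set \<Rightarrow> 'a set \<Rightarrow> 'a set" where
  "colon_ideal R A B = {x \<in> carrier R. \<forall>b\<in>B. x \<otimes>\<^bsub>R\<^esub> b \<in> A}"

text \<open>Powers of an ideal are taken in the semiring \<^const>\<open>ideals_set\<close> of ideals of \<open>R\<close>,
  whose multiplication is the product of ideals.\<close>

definition ratliff_rush_closure :: "('a, 'm) ring_scheme \<Rightarrow> 'a set \<Rightarrow> 'a set" where
  "ratliff_rush_closure R I =
     (\<Union>n\<in>{n::nat. 1 \<le> n}.
        colon_ideal R (I [^]\<^bsub>ideals_set R\<^esub> (n + 1)) (I [^]\<^bsub>ideals_set R\<^esub> n))"

text \<open>HOL-Algebra has no construction of the quotient field of a domain \<open>R\<close>. It is described here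
  as a field \<open>K\<close> with an embedding \<open>\<phi>\<close> of \<open>R\<close> such that every element of \<open>K\<close> is a fraction of
  elements of \<open>R\<close>; this determines \<open>(K, \<phi>)\<close> up to a unique isomorphism.\<close>

definition is_quotient_field ::
    "('a, 'm) ring_scheme \<Rightarrow> ('b, 'n) ring_scheme \<Rightarrow> ('a \<Rightarrow> 'b) \<Rightarrow> bool" where
  "is_quotient_field R K \<phi> \<longleftrightarrow>
     field K \<and> \<phi> \<in> ring_hom R K \<and> inj_on \<phi> (carrier R) \<and>
     (\<forall>x\<in>carrier K. \<exists>a\<in>carrier R. \<exists>b\<in>carrier R - {\<zero>\<^bsub>R\<^esub>}.
        x = \<phi> a \<otimes>\<^bsub>K\<^esub> inv\<^bsub>K\<^esub> (\<phi> b))"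

text \<open>Polynomials are lists of coefficients starting with the leading one; the zero polynomial
  \<open>[]\<close> has an unspecified leading coefficient and has to be excluded.\<close>

definition integral_closure :: "('b, 'n) ring_scheme \<Rightarrow> 'b set \<Rightarrow> 'b set" where
  "integral_closure K A =
     {x \<in> carrier K. \<exists>p\<in>carrier (A[X]\<^bsub>K\<^esub>).
        p \<noteq> [] \<and> lead_coeff p = \<one>\<^bsub>K\<^esub> \<and> ring.eval K p x = \<zero>\<^bsub>K\<^esub>}"

text \<open>In what follows \<open>D\<close> is a subring of its quotient field \<open>K\<close>. The product of \<open>D\<close>-submodules
  of \<open>K\<close> is \<^term>\<open>ideal_prod K\<close>, the set of finite sums of products.\<close>

definition fractional_ideal :: "('b, 'n) ring_scheme \<Rightarrow> 'b set \<Rightarrow> 'b set \<Rightarrow> bool" where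
  "fractional_ideal K D J \<longleftrightarrow>
     additive_subgroup J K \<and> (\<forall>d\<in>D. \<forall>x\<in>J. d \<otimes>\<^bsub>K\<^esub> x \<in> J) \<and>
     (\<exists>d\<in>D - {\<zero>\<^bsub>K\<^esub>}. \<forall>x\<in>J. d \<otimes>\<^bsub>K\<^esub> x \<in> D)"

definition invertible_ideal :: "('b, 'n) ring_scheme \<Rightarrow> 'b set \<Rightarrow> 'b set \<Rightarrow> bool" where
  "invertible_ideal K D I \<longleftrightarrow> (\<exists>J. fractional_ideal K D J \<and> ideal_prod K I J = D)"

definition prufer_domain :: "('b, 'n) ring_scheme \<Rightarrow> 'b set \<Rightarrow> bool" where
  "prufer_domain K D \<longleftrightarrow>
     subdomain D K \<and> is_quotient_field (K\<lparr>carrier := D\<rparr>) K id \<and>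
     (\<forall>I. fg_ideal (K\<lparr>carrier := D\<rparr>) I \<and> I \<noteq> {\<zero>\<^bsub>K\<^esub>} \<longrightarrow> invertible_ideal K D I)"

end

theory Submission
  imports Defs "HOL-Algebra.Finite_Extensions"
begin

text \<open>Write \<open>A\<close> for the image of \<open>R\<close> in \<open>K\<close> and \<open>D\<close> for the integral closure of \<open>A\<close> in \<open>K\<close>.

The hypothesis is applied to the ideals \<open>I = (a\<^sup>4, a\<^sup>3b, ab\<^sup>3, b\<^sup>4)\<close>. The only monomial of
degree four in \<open>a\<close> and \<open>b\<close> that is not a listed generator is \<open>a\<^sup>2b\<^sup>2\<close>, and \<open>a\<^sup>2b\<^sup>2I \<subseteq> I\<^sup>2\<close>, so
\<open>a\<^sup>2b\<^sup>2\<close> lies in the Ratliff-Rush closure of \<open>I\<close>, that is, in \<open>I\<close>. Dividing by \<open>b\<^sup>4\<close>, every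
\<open>u = a/b\<close> satisfies \<open>u\<^sup>2 = w u\<^sup>4 + x u\<^sup>3 + y u + z\<close> with coefficients in \<open>A\<close>: it is a root of a
polynomial over \<open>A\<close> one of whose coefficients is a unit (\<open>ratliff_rush_quartic\<close>).

Since \<open>D\<close> is integrally closed, the partial values \<open>p = w u + x\<close> and \<open>q = p u - 1\<close> of Horner's
scheme satisfy \<open>p, p u, q, q u \<in> D\<close>, while \<open>p u - q = 1\<close> (\<open>quartic_unit_coefficient\<close>). This says that
the fractional ideal generated by \<open>1\<close> and \<open>u\<close> is invertible. Hence all two-generated ideals of \<open>D\<close>
are invertible, and an induction on the number of generators (\<open>one_mem_prod_inverse_ideal\<close>)
extends this to all nonzero finitely generated ideals of \<open>D\<close>.

That \<open>D\<close> is an integrally closed ring rests on the fact that an element which multiplies a nonzero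
finitely generated \<open>A\<close>-submodule of \<open>K\<close> into itself is integral over \<open>A\<close> (\<open>integral_if_stable\<close>).
It is obtained without determinants: \<open>x \<noteq> 0\<close> is integral over \<open>A\<close> if \<open>x \<in> A[1/x]\<close>, and this follows
from Nakayama's lemma for the ideal of \<open>A[1/x]\<close> generated by \<open>1/x\<close>.\<close>

section \<open>Submodules spanned by finite lists\<close>

context ring
begin

text \<open>\<^term>\<open>Span A ms\<close> is used here for a subring \<open>A\<close> of the ambient ring, where it is the
\<open>A\<close>-submodule generated by the list \<open>ms\<close>.\<close>

declare Span.simps [simp del]

lemma Span_Nil: "Span A [] = {\<zero>}"
  by (simp add: Span.simps)

lemma Span_Cons_iff:
  "v \<in> Span A (m # ms) \<longleftrightarrow> (\<exists>a\<in>A. \<exists>w\<in>Span A ms. v = a \<otimes> m \<oplus> w)"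
  by (auto simp: Span.simps line_extension_mem_iff)

lemma Span_ConsI:
  "a \<in> A \<Longrightarrow> w \<in> Span A ms \<Longrightarrow> v = a \<otimes> m \<oplus> w \<Longrightarrow> v \<in> Span A (m # ms)"
  by (auto simp: Span_Cons_iff)

lemma Span_closed:
  assumes "A \<subseteq> carrier R" "set ms \<subseteq> carrier R" "v \<in> Span A ms"
  shows "v \<in> carrier R"
  using assms(2,3) by (induction ms arbitrary: v) (use assms(1) in \<open>auto simp: Span_Nil Span_Cons_iff\<close>)

lemma Span_mono_ring: "A \<subseteq> B \<Longrightarrow> Span A ms \<subseteq> Span B ms"
proof (induction ms)
  case (Cons m ms)
  show ?case
  proof
    fix v assume "v \<in> Span A (m # ms)"
    then obtain a w where "a \<in> A" "w \<in> Span A ms" "v = a \<otimes> m \<oplus> w"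
      by (auto simp: Span_Cons_iff)
    then show "v \<in> Span B (m # ms)" using Cons by (intro Span_ConsI) auto
  qed
qed (simp add: Span_Nil)

lemma zero_in_Span:
  assumes "subring A R" "set ms \<subseteq> carrier R"
  shows "\<zero> \<in> Span A ms"
  using assms(2)
proof (induction ms)
  case (Cons m ms)
  have "\<zero> = \<zero> \<otimes> m \<oplus> \<zero>" using Cons by simp
  then show ?case
    using Cons subringE(2)[OF assms(1)] by (intro Span_ConsI) auto
qed (simp add: Span_Nil)

lemma Span_add:
  assumes "subring A R" "set ms \<subseteq> carrier R" "v \<in> Span A ms" "w \<in> Span A ms"
  shows "v \<oplus> w \<in> Span A ms"
  using assms(2-)
proof (induction ms arbitrary: v w)
  case (Cons m ms)
  note A = subringE[OF assms(1)]
  from Cons.prems obtain a v' b w' where *: "a \<in> A" "v' \<in> Span A ms" "v = a \<otimes> m \<oplus> v'"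
      "b \<in> A" "w' \<in> Span A ms" "w = b \<otimes> m \<oplus> w'"
    by (auto simp: Span_Cons_iff)
  have c: "a \<in> carrier R" "b \<in> carrier R" "v' \<in> carrier R" "w' \<in> carrier R" "m \<in> carrier R"
    using * A(1) Cons.prems Span_closed[OF A(1)] by auto
  have "v \<oplus> w = (a \<oplus> b) \<otimes> m \<oplus> (v' \<oplus> w')"
    unfolding * using c by algebra
  moreover have "v' \<oplus> w' \<in> Span A ms" using * Cons by auto
  ultimately show ?case
    using * A(7) by (intro Span_ConsI)
qed (simp add: Span_Nil)

lemma Span_smult:
  assumes "subring A R" "set ms \<subseteq> carrier R" "a \<in> A" "v \<in> Span A ms"
  shows "a \<otimes> v \<in> Span A ms"
  using assms(2,4)
proof (induction ms arbitrary: v)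
  case Nil
  then show ?case using subringE(1)[OF assms(1)] assms(3) by (auto simp: Span_Nil)
next
  case (Cons m ms)
  note A = subringE[OF assms(1)]
  from Cons.prems obtain b v' where *: "b \<in> A" "v' \<in> Span A ms" "v = b \<otimes> m \<oplus> v'"
    by (auto simp: Span_Cons_iff)
  have c: "a \<in> carrier R" "b \<in> carrier R" "v' \<in> carrier R" "m \<in> carrier R"
    using * A(1) Cons.prems Span_closed[OF A(1)] assms(3) by auto
  have "a \<otimes> v = (a \<otimes> b) \<otimes> m \<oplus> a \<otimes> v'"
    unfolding * using c by algebra
  moreover have "a \<otimes> v' \<in> Span A ms" using * Cons by auto
  ultimately show ?case
    using * A(6) assms(3) by (intro Span_ConsI)
qed

lemma Span_gen:
  assumes "subring A R" "set ms \<subseteq> carrier R" "m \<in> set ms"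
  shows "m \<in> Span A ms"
  using assms(2,3)
proof (induction ms)
  case (Cons n ms)
  note A = subringE[OF assms(1)]
  show ?case
  proof (cases "m = n")
    case True
    then have "m = \<one> \<otimes> n \<oplus> \<zero>" using Cons by simp
    then show ?thesis
      using A(3) zero_in_Span[OF assms(1), of ms] Cons True by (intro Span_ConsI) auto
  next
    case False
    then have "m \<in> Span A ms" "m = \<zero> \<otimes> n \<oplus> m" using Cons by auto
    then show ?thesis
      using A(2) by (intro Span_ConsI)
  qed
qed simp

lemma Span_in_subring:
  assumes "subring B R" "A \<subseteq> B" "set ms \<subseteq> B"
  shows "Span A ms \<subseteq> B"
proof
  fix v assume "v \<in> Span A ms"
  then show "v \<in> B" using assms(3)
  proof (induction ms arbitrary: v)
    case Nil
    then show ?case using subringE(2)[OF assms(1)] by (simp add: Span_Nil)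
  next
    case (Cons m ms)
    then obtain a w where "a \<in> A" "w \<in> Span A ms" "v = a \<otimes> m \<oplus> w"
      by (auto simp: Span_Cons_iff)
    then show ?case using Cons assms(2) subringE(6,7)[OF assms(1)] by auto
  qed
qed

lemma Span_trivial:
  assumes "A \<subseteq> carrier R" "set ms \<subseteq> {\<zero>}"
  shows "Span A ms \<subseteq> {\<zero>}"
  using assms(2)
proof (induction ms)
  case (Cons m ms)
  then have "m = \<zero>" "Span A ms \<subseteq> {\<zero>}" by auto
  moreover have "a \<otimes> \<zero> \<oplus> \<zero> = \<zero>" if "a \<in> A" for a using that assms(1) by auto
  ultimately show ?case by (fastforce simp: Span_Cons_iff)
qed (simp add: Span_Nil)

lemma Span_append:
  assumes "A \<subseteq> carrier R" "set us \<subseteq> carrier R" "set vs \<subseteq> carrier R"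
  shows "v \<in> Span A (us @ vs) \<longleftrightarrow> (\<exists>x\<in>Span A us. \<exists>y\<in>Span A vs. v = x \<oplus> y)"
  using assms(2)
proof (induction us arbitrary: v)
  case Nil
  then show ?case using Span_closed[OF assms(1,3)] by (auto simp: Span_Nil)
next
  case (Cons u us)
  then have IH: "\<And>w. w \<in> Span A (us @ vs) \<longleftrightarrow> (\<exists>x\<in>Span A us. \<exists>y\<in>Span A vs. w = x \<oplus> y)"
    and u: "u \<in> carrier R" and us: "set us \<subseteq> carrier R" by auto
  have assoc: "a \<otimes> u \<oplus> (x \<oplus> y) = a \<otimes> u \<oplus> x \<oplus> y"
    if "a \<in> A" "x \<in> Span A us" "y \<in> Span A vs" for a x y
    using that u us Span_closed[OF assms(1)] assms(1,3) by (simp add: a_assoc subset_iff)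
  show ?case
  proof
    assume "v \<in> Span A ((u # us) @ vs)"
    then obtain a x y where *: "a \<in> A" "x \<in> Span A us" "y \<in> Span A vs" "v = a \<otimes> u \<oplus> (x \<oplus> y)"
      by (auto simp: Span_Cons_iff IH)
    then show "\<exists>x\<in>Span A (u # us). \<exists>y\<in>Span A vs. v = x \<oplus> y"
      using assoc by (intro bexI[of _ "a \<otimes> u \<oplus> x"] bexI[of _ y] Span_ConsI) auto
  next
    assume "\<exists>x\<in>Span A (u # us). \<exists>y\<in>Span A vs. v = x \<oplus> y"
    then obtain a x y where "a \<in> A" "x \<in> Span A us" "y \<in> Span A vs" "v = a \<otimes> u \<oplus> x \<oplus> y"
      by (auto simp: Span_Cons_iff)
    then have "v = a \<otimes> u \<oplus> (x \<oplus> y)" "a \<in> A" "x \<oplus> y \<in> Span A (us @ vs)"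
      using assoc IH by auto
    then show "v \<in> Span A ((u # us) @ vs)"
      by (auto intro: Span_ConsI)
  qed
qed

lemma Span_map_mult:
  assumes "A \<subseteq> carrier R" "set cs \<subseteq> carrier R" "u \<in> carrier R"
  shows "v \<in> Span A (map (\<lambda>c. c \<otimes> u) cs) \<longleftrightarrow> (\<exists>c\<in>Span A cs. v = c \<otimes> u)"
  using assms(2)
proof (induction cs arbitrary: v)
  case Nil
  then show ?case using assms(3) by (auto simp: Span_Nil)
next
  case (Cons c cs)
  then have IH: "\<And>w. w \<in> Span A (map (\<lambda>c. c \<otimes> u) cs) \<longleftrightarrow> (\<exists>d\<in>Span A cs. w = d \<otimes> u)"
    and c: "c \<in> carrier R" and cs: "set cs \<subseteq> carrier R" by auto
  have eq: "a \<otimes> (c \<otimes> u) \<oplus> d \<otimes> u = (a \<otimes> c \<oplus> d) \<otimes> u" if "a \<in> A" "d \<in> Span A cs" for a d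
  proof -
    have "a \<in> carrier R" "d \<in> carrier R"
      using that Span_closed[OF assms(1) cs] assms(1) by auto
    then show ?thesis using c assms(3) by algebra
  qed
  show ?case
  proof
    assume "v \<in> Span A (map (\<lambda>c. c \<otimes> u) (c # cs))"
    then obtain a d where *: "a \<in> A" "d \<in> Span A cs" "v = a \<otimes> (c \<otimes> u) \<oplus> d \<otimes> u"
      by (auto simp: Span_Cons_iff IH)
    then have "v = (a \<otimes> c \<oplus> d) \<otimes> u" using eq by simp
    moreover have "a \<otimes> c \<oplus> d \<in> Span A (c # cs)" using * by (intro Span_ConsI) auto
    ultimately show "\<exists>e\<in>Span A (c # cs). v = e \<otimes> u" by blast
  next
    assume "\<exists>e\<in>Span A (c # cs). v = e \<otimes> u"
    then obtain a d where *: "a \<in> A" "d \<in> Span A cs" "v = (a \<otimes> c \<oplus> d) \<otimes> u"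
      by (auto simp: Span_Cons_iff)
    then have "v = a \<otimes> (c \<otimes> u) \<oplus> d \<otimes> u" using eq by simp
    moreover have "d \<otimes> u \<in> Span A (map (\<lambda>c. c \<otimes> u) cs)" using IH * by auto
    ultimately show "v \<in> Span A (map (\<lambda>c. c \<otimes> u) (c # cs))"
      using *(1) by (auto intro: Span_ConsI)
  qed
qed

text \<open>If \<open>C\<close> is finitely generated as an \<open>A\<close>-module, then a finitely generated \<open>C\<close>-module is finitely
generated over \<open>A\<close>, by the products of the generators.\<close>

lemma Span_trans:
  assumes "A \<subseteq> carrier R" "set cs \<subseteq> carrier R" "set ms \<subseteq> carrier R"
  shows "\<exists>ls. set ls \<subseteq> carrier R \<and> Span A ls = Span (Span A cs) ms"
  using assms(3)
proof (induction ms)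
  case Nil
  show ?case by (intro exI[of _ "[]"]) (simp add: Span_Nil)
next
  case (Cons m ms)
  then obtain ls where ls: "set ls \<subseteq> carrier R" "Span A ls = Span (Span A cs) ms"
    and m: "m \<in> carrier R" by auto
  have ms': "set (map (\<lambda>c. c \<otimes> m) cs) \<subseteq> carrier R" using m assms(2) by auto
  have "Span A (map (\<lambda>c. c \<otimes> m) cs) = (\<lambda>c. c \<otimes> m) ` Span A cs"
    using Span_map_mult[OF assms(1,2) m] by blast
  then have "v \<in> Span A (map (\<lambda>c. c \<otimes> m) cs @ ls) \<longleftrightarrow> v \<in> Span (Span A cs) (m # ms)" for v
    by (simp only: Span_append[OF assms(1) ms' ls(1)] Span_Cons_iff ls(2) bex_simps)
  then have "Span A (map (\<lambda>c. c \<otimes> m) cs @ ls) = Span (Span A cs) (m # ms)" by blast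
  moreover have "set (map (\<lambda>c. c \<otimes> m) cs @ ls) \<subseteq> carrier R" using ls(1) ms' by simp
  ultimately show ?case by blast
qed

end

text \<open>Nakayama's lemma for the ideal \<open>yB\<close>, in the form that allows an induction on the generators: if
\<open>r M \<subseteq> y M\<close> for some \<open>r \<in> 1 + yB\<close>, then some element of \<open>1 + yB\<close> annihilates \<open>M\<close>.\<close>

lemma (in cring) Nakayama:
  assumes "subring B R" "y \<in> B" "set ms \<subseteq> carrier R"
    and "\<exists>b\<in>B. r = \<one> \<oplus> y \<otimes> b"
    and "\<And>m. m \<in> set ms \<Longrightarrow> \<exists>v\<in>Span B ms. r \<otimes> m = y \<otimes> v"
  shows "\<exists>b\<in>B. \<forall>m\<in>set ms. (\<one> \<oplus> y \<otimes> b) \<otimes> m = \<zero>"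
  using assms(3-)
proof (induction ms arbitrary: r)
  case Nil
  then show ?case using subringE(2)[OF assms(1)] by auto
next
  case (Cons m ms)
  note B = subringE[OF assms(1)]
  note BC = subsetD[OF B(1)]
  have m: "m \<in> carrier R" and ms: "set ms \<subseteq> carrier R" using Cons.prems by auto
  note SC = Span_closed[OF B(1) ms]
  from Cons.prems obtain b where b: "b \<in> B" "r = \<one> \<oplus> y \<otimes> b" by auto
  from Cons.prems(3)[of m] obtain c v where cv: "c \<in> B" "v \<in> Span B ms" "r \<otimes> m = y \<otimes> (c \<otimes> m \<oplus> v)"
    by (auto simp: Span_Cons_iff)
  \<comment> \<open>The term \<open>y c m\<close> is moved to the left: \<open>q m = y v\<close>, where \<open>v\<close> no longer involves \<open>m\<close>.\<close>
  define q where "q = r \<ominus> y \<otimes> c"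
  note C = BC[OF b(1)] BC[OF cv(1)] SC[OF cv(2)] BC[OF assms(2)] m
  have rB: "r \<in> B" using b B assms(2) by auto
  have q: "q = \<one> \<oplus> y \<otimes> (b \<ominus> c)"
    unfolding q_def b(2) using C by algebra
  have qB: "q \<in> B" using q b cv B assms(2) by (auto simp: a_minus_def)
  have qm: "q \<otimes> m = y \<otimes> v"
  proof -
    have "q \<otimes> m = r \<otimes> m \<ominus> y \<otimes> c \<otimes> m"
      unfolding q_def using C BC[OF rB] by algebra
    also have "\<dots> = y \<otimes> v" unfolding cv(3) using C by algebra
    finally show ?thesis .
  qed
  have "\<exists>d\<in>B. \<forall>n\<in>set ms. (\<one> \<oplus> y \<otimes> d) \<otimes> n = \<zero>"
  proof (rule Cons.IH[OF ms, of "q \<otimes> r"])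
    have "q \<otimes> r = \<one> \<oplus> y \<otimes> (b \<oplus> (b \<ominus> c) \<otimes> r)"
      unfolding q using b(2) C BC[OF rB] by algebra
    moreover have "b \<oplus> (b \<ominus> c) \<otimes> r \<in> B"
      using b cv B rB by (auto simp: a_minus_def)
    ultimately show "\<exists>d\<in>B. q \<otimes> r = \<one> \<oplus> y \<otimes> d" by blast
  next
    fix n assume n: "n \<in> set ms"
    then obtain e w where ew: "e \<in> B" "w \<in> Span B ms" "r \<otimes> n = y \<otimes> (e \<otimes> m \<oplus> w)"
      using Cons.prems(3)[of n] by (auto simp: Span_Cons_iff)
    have "q \<otimes> r \<otimes> n = y \<otimes> (e \<otimes> (q \<otimes> m) \<oplus> q \<otimes> w)"
      using ew(3) BC[OF qB] BC[OF rB] BC[OF ew(1)] SC[OF ew(2)] C n ms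
      by (subst m_assoc) (auto, algebra)
    then have "q \<otimes> r \<otimes> n = y \<otimes> ((e \<otimes> y) \<otimes> v \<oplus> q \<otimes> w)"
      unfolding qm using BC[OF ew(1)] C by (simp add: m_assoc)
    moreover have "(e \<otimes> y) \<otimes> v \<oplus> q \<otimes> w \<in> Span B ms"
      using Span_smult[OF assms(1) ms] Span_add[OF assms(1) ms] B(6) ew cv qB assms(2) by auto
    ultimately show "\<exists>v\<in>Span B ms. q \<otimes> r \<otimes> n = y \<otimes> v" by blast
  qed
  then obtain d where d: "d \<in> B" "\<And>n. n \<in> set ms \<Longrightarrow> (\<one> \<oplus> y \<otimes> d) \<otimes> n = \<zero>" by blast
  have S0: "(\<one> \<oplus> y \<otimes> d) \<otimes> w = \<zero>" if "w \<in> Span B ms" for w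
    using d(2) ms that
  proof (induction ms arbitrary: w)
    case (Cons n ns)
    then obtain a w' where *: "a \<in> B" "w' \<in> Span B ns" "w = a \<otimes> n \<oplus> w'"
      by (auto simp: Span_Cons_iff)
    have "w' \<in> carrier R" "n \<in> carrier R" using * Span_closed[OF B(1), of ns] Cons by auto
    then have "(\<one> \<oplus> y \<otimes> d) \<otimes> w = a \<otimes> ((\<one> \<oplus> y \<otimes> d) \<otimes> n) \<oplus> (\<one> \<oplus> y \<otimes> d) \<otimes> w'"
      unfolding * using BC[OF *(1)] BC[OF d(1)] C by algebra
    also have "\<dots> = \<zero>" using Cons * BC[OF *(1)] by auto
    finally show ?case .
  qed (use d BC C in \<open>auto simp: Span_Nil\<close>)
  have dC: "d \<in> carrier R" using BC d by auto
  have *: "(\<one> \<oplus> y \<otimes> d) \<otimes> q = \<one> \<oplus> y \<otimes> (b \<ominus> c \<oplus> d \<otimes> q)"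
    unfolding q using dC C by algebra
  have "(\<one> \<oplus> y \<otimes> d) \<otimes> q \<otimes> n = \<zero>" if "n \<in> set (m # ms)" for n
  proof (cases "n = m")
    case True
    have "(\<one> \<oplus> y \<otimes> d) \<otimes> q \<otimes> m = y \<otimes> ((\<one> \<oplus> y \<otimes> d) \<otimes> v)"
      using qm dC C BC[OF qB] by (simp add: m_assoc, algebra)
    then show ?thesis using True S0 cv C by simp
  next
    case False
    then have n: "n \<in> set ms" "n \<in> carrier R" using that ms by auto
    have "(\<one> \<oplus> y \<otimes> d) \<otimes> q \<otimes> n = q \<otimes> ((\<one> \<oplus> y \<otimes> d) \<otimes> n)"
      using n dC C BC[OF qB] by algebra
    then show ?thesis using d(2) n BC[OF qB] by simp
  qed
  moreover have "b \<ominus> c \<oplus> d \<otimes> q \<in> B" using B b cv d qB by (auto simp: a_minus_def)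
  ultimately show ?case unfolding * by blast
qed

section \<open>Integral elements\<close>

context domain
begin

text \<open>A monic polynomial is encoded by the list \<open>as\<close> of its coefficients below the leading one.\<close>

lemma integral_closure_iff:
  assumes "A \<subseteq> carrier R" "\<one> \<in> A"
  shows "x \<in> integral_closure R A \<longleftrightarrow>
    x \<in> carrier R \<and> (\<exists>as. set as \<subseteq> A \<and> x [^] length as \<oplus> eval as x = \<zero>)"
proof -
  have *: "x [^] length as \<oplus> eval as x = eval (\<one> # as) x" if "x \<in> carrier R" for as
    using that by simp
  show ?thesis
  proof
    assume "x \<in> integral_closure R A"
    then obtain p where x: "x \<in> carrier R" and p: "p \<in> carrier (A[X])" "p \<noteq> []"
        "lead_coeff p = \<one>" "eval p x = \<zero>"
      unfolding integral_closure_def by blast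
    then obtain as where "p = \<one> # as"
      by (cases p) auto
    with p(1) have "set as \<subseteq> A"
      by (simp add: univ_poly_def polynomial_def)
    moreover have "eval (\<one> # as) x = \<zero>"
      using p(4) \<open>p = \<one> # as\<close> by metis
    ultimately
    show "x \<in> carrier R \<and> (\<exists>as. set as \<subseteq> A \<and> x [^] length as \<oplus> eval as x = \<zero>)"
      using x *[OF x] by metis
  next
    assume "x \<in> carrier R \<and> (\<exists>as. set as \<subseteq> A \<and> x [^] length as \<oplus> eval as x = \<zero>)"
    then obtain as where x: "x \<in> carrier R"
      and as': "set as \<subseteq> A" "x [^] length as \<oplus> eval as x = \<zero>"
      by blast
    then have as: "set as \<subseteq> A" "eval (\<one> # as) x = \<zero>"
      using *[OF x, of as] by (simp_all only:)
    have "\<one> # as \<in> carrier (A[X])"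
      using as assms by (simp add: univ_poly_def polynomial_def)
    with x as show "x \<in> integral_closure R A"
      unfolding integral_closure_def by force
  qed
qed

lemma subring_subset_integral_closure:
  assumes "subring A R" shows "A \<subseteq> integral_closure R A"
proof
  fix a assume a: "a \<in> A"
  note A = subringE[OF assms]
  have "set [\<ominus> a] \<subseteq> A" using a A by simp
  moreover have "a [^] length [\<ominus> a] \<oplus> eval [\<ominus> a] a = \<zero>"
    using a A(1) by (auto simp: r_neg)
  ultimately show "a \<in> integral_closure R A"
    using integral_closure_iff[OF A(1,3)] a A(1) by blast
qed

lemma integral_closure_mono:
  assumes "A \<subseteq> B" shows "integral_closure R A \<subseteq> integral_closure R B"
  using assms unfolding integral_closure_def univ_poly_def polynomial_def by auto

lemma set_exp_base: "set (exp_base x n) = {x [^] i | i. i < n}"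
  by (auto simp: exp_base_def)

text \<open>If \<open>x\<close> is a root of a monic polynomial of degree \<open>n\<close> over \<open>C\<close>, then \<open>C[x]\<close>, which is
\<^term>\<open>simple_extension C x\<close>, is spanned over \<open>C\<close> by the powers of \<open>x\<close> with exponent below \<open>n\<close>.\<close>

lemma simple_extension_eq_Span:
  assumes C: "subring C R" and x: "x \<in> carrier R"
    and as: "set as \<subseteq> C" "x [^] length as \<oplus> eval as x = \<zero>"
  shows "simple_extension C x = Span C (exp_base x (length as))"
proof
  define n where "n = length as"
  define S where "S = Span C (exp_base x n)"
  note CC = subringE[OF C]
  have eb: "set (exp_base x n) \<subseteq> carrier R"
    using x by (auto simp: set_exp_base)
  have gen: "x [^] i \<in> S" if "i < n" for i
    unfolding S_def using Span_gen[OF C eb] that by (auto simp: set_exp_base)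
  note smult = Span_smult[OF C eb, folded S_def] and add = Span_add[OF C eb, folded S_def]
  have zero: "\<zero> \<in> S" unfolding S_def by (rule zero_in_Span[OF C eb])
  have ev: "eval bs x \<in> S" if "set bs \<subseteq> C" "length bs \<le> n" for bs
    using that by (induction bs) (auto intro!: zero add smult gen)
  have xn: "x [^] n \<in> S"
  proof -
    have "x [^] n = \<ominus> eval as x"
      using as(2) x eval_in_carrier[of as x] as(1) CC(1) unfolding n_def
      by (intro minus_equality[symmetric]) (auto simp: a_comm)
    also have "\<dots> = (\<ominus> \<one>) \<otimes> eval as x"
      using x eval_in_carrier[of as x] as(1) CC(1) by (simp add: l_minus subset_trans)
    also have "\<dots> \<in> S" using ev[OF as(1)] CC by (intro smult) (auto simp: n_def)
    finally show ?thesis .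
  qed
  have "n \<noteq> 0"
    using as(2) unfolding n_def by (cases as) auto
  have times: "v \<otimes> x \<in> S" if "v \<in> Span C (exp_base x k)" "k \<le> n" for v k
    using that
  proof (induction k arbitrary: v)
    case 0
    then show ?case using x zero by (simp add: exp_base_def Span_Nil)
  next
    case (Suc k)
    have "exp_base x (Suc k) = x [^] k # exp_base x k" by (simp add: exp_base_def)
    with Suc.prems obtain a w where w: "a \<in> C" "w \<in> Span C (exp_base x k)" "v = a \<otimes> x [^] k \<oplus> w"
      by (auto simp: Span_Cons_iff)
    have c: "a \<in> carrier R" "w \<in> carrier R" "x [^] k \<in> carrier R"
      using w CC(1) x Span_closed[OF CC(1) _ w(2)] by (auto simp: set_exp_base)
    have "v \<otimes> x = a \<otimes> x [^] Suc k \<oplus> w \<otimes> x"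
      using w(3) c x by (simp add: l_distr m_assoc)
    moreover have "x [^] Suc k \<in> S"
      using gen[of "Suc k"] xn Suc.prems by (cases "Suc k = n") auto
    moreover have "w \<otimes> x \<in> S" using Suc w by simp
    ultimately show ?case using add smult w(1) by simp
  qed
  show "simple_extension C x \<subseteq> Span C (exp_base x (length as))"
  proof
    fix v assume "v \<in> simple_extension C x"
    then have "v \<in> S"
    proof (induction rule: simple_extension.induct)
      case (lin k1 k2)
      have "k2 = k2 \<otimes> x [^] (0::nat)" using lin CC(1) by auto
      then have "k2 \<in> S" using smult[OF lin(2) gen[of 0]] \<open>n \<noteq> 0\<close> by simp
      moreover have "k1 \<otimes> x \<in> S" using times[of k1 n] lin by (simp add: S_def)
      ultimately show ?case by (rule add[rotated])
    qed (rule zero)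
    then show "v \<in> Span C (exp_base x (length as))" by (simp add: S_def n_def)
  qed
  have sub: "subring (simple_extension C x) R" by (rule simple_extension_is_subring[OF C x])
  have "x [^] i \<in> simple_extension C x" for i :: nat
    by (induction i)
      (use subringE(3,6)[OF sub] simple_extension_mem[OF C x] in auto)
  then show "Span C (exp_base x (length as)) \<subseteq> simple_extension C x"
    using simple_extension_incl[OF CC(1) x]
    by (intro Span_in_subring[OF sub]) (auto simp: set_exp_base)
qed

end

context field
begin

text \<open>Elements \<open>b\<close> of \<open>A[1/x]\<close> become polynomial expressions in \<open>x\<close> after multiplication by a power
\<open>x\<^sup>n\<close>, and the degree of the expression is at most \<open>n\<close>.\<close>

lemma simple_extension_inv_eval:
  assumes A: "subring A R" and x: "x \<in> carrier R" "x \<noteq> \<zero>"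
    and "b \<in> simple_extension A (inv x)"
  shows "\<exists>as. set as \<subseteq> A \<and> as \<noteq> [] \<and> x [^] (length as - 1) \<otimes> b = eval as x"
  using assms(4)
proof (induction rule: simple_extension.induct)
  case zero
  then show ?case using x subringE(2)[OF A] by (intro exI[of _ "[\<zero>]"]) auto
next
  case (lin k1 k2)
  then obtain as where as: "set as \<subseteq> A" "as \<noteq> []" "x [^] (length as - 1) \<otimes> k1 = eval as x"
    by blast
  have ix: "inv x \<in> carrier R" "x \<otimes> inv x = \<one>"
    using x by (simp_all add: field_Units)
  have k: "k1 \<in> carrier R" "k2 \<in> carrier R"
    using lin simple_extension_in_carrier[OF subringE(1)[OF A] ix(1)] subringE(1)[OF A] by auto
  define n where "n = length as - 1"
  have n: "length as = Suc n" using as by (simp add: n_def)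
  have "x [^] Suc n \<otimes> (k1 \<otimes> inv x \<oplus> k2) = (x [^] n \<otimes> k1) \<otimes> (x \<otimes> inv x) \<oplus> k2 \<otimes> x [^] Suc n"
    using x(1) k ix(1) nat_pow_closed[OF x(1), of n] by (simp, algebra)
  also have "\<dots> = eval (k2 # as) x"
    using as(3) k x nat_pow_closed[OF x(1), of n] eval_in_carrier[of as x] as(1) subringE(1)[OF A]
    unfolding ix n_def[symmetric]
    by (simp add: n a_comm subset_iff)
  finally show ?case using as lin n by (intro exI[of _ "k2 # as"]) auto
qed

lemma integral_if_stable:
  assumes A: "subring A R" and x: "x \<in> carrier R"
    and ms: "set ms \<subseteq> carrier R" "\<not> set ms \<subseteq> {\<zero>}"
    and stable: "\<And>m. m \<in> set ms \<Longrightarrow> x \<otimes> m \<in> Span A ms"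
  shows "x \<in> integral_closure R A"
proof (cases "x = \<zero>")
  case True
  then show ?thesis using subring_subset_integral_closure[OF A] subringE(2)[OF A] by auto
next
  case False
  define y where "y = inv x"
  have y: "y \<in> carrier R" "x \<otimes> y = \<one>"
    using x False by (simp_all add: y_def field_Units)
  define B where "B = simple_extension A y"
  have B: "subring B R"
    unfolding B_def by (rule simple_extension_is_subring[OF A y(1)])
  have AB: "A \<subseteq> B"
    unfolding B_def by (rule simple_extension_incl[OF subringE(1)[OF A] y(1)])
  have yB: "y \<in> B"
    unfolding B_def by (rule simple_extension_mem[OF A y(1)])
  have "\<exists>b\<in>B. \<forall>m\<in>set ms. (\<one> \<oplus> y \<otimes> b) \<otimes> m = \<zero>"
  proof (rule Nakayama[OF B yB ms(1), of \<one>])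
    show "\<exists>b\<in>B. \<one> = \<one> \<oplus> y \<otimes> b"
      using subringE(2)[OF B] y by (intro bexI[of _ \<zero>]) auto
  next
    fix m assume m: "m \<in> set ms"
    then have mc: "m \<in> carrier R" using ms by auto
    have "\<one> \<otimes> m = (x \<otimes> y) \<otimes> m" using y by simp
    also have "\<dots> = y \<otimes> (x \<otimes> m)" using mc x y(1) by algebra
    finally show "\<exists>v\<in>Span B ms. \<one> \<otimes> m = y \<otimes> v"
      using stable[OF m] Span_mono_ring[OF AB] by blast
  qed
  then obtain b where b: "b \<in> B" "\<And>m. m \<in> set ms \<Longrightarrow> (\<one> \<oplus> y \<otimes> b) \<otimes> m = \<zero>" by blast
  obtain m where m: "m \<in> set ms" "m \<noteq> \<zero>" "m \<in> carrier R" using ms by auto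
  have bC: "b \<in> carrier R" using b subringE(1)[OF B] by auto
  have "\<one> \<oplus> y \<otimes> b = \<zero>"
    using b(2)[OF m(1)] m bC y integral_iff[of "\<one> \<oplus> y \<otimes> b" m] by auto
  moreover have "x \<oplus> b = x \<oplus> (x \<otimes> y) \<otimes> b" using y bC x by simp
  moreover have "\<dots> = x \<otimes> (\<one> \<oplus> y \<otimes> b)" using y(1) bC x by algebra
  ultimately have xb: "x \<oplus> b = \<zero>" using x by simp
  obtain as where as: "set as \<subseteq> A" "as \<noteq> []" "x [^] (length as - 1) \<otimes> b = eval as x"
    using simple_extension_inv_eval[OF A x False, of b] b(1) unfolding B_def y_def by blast
  have "x [^] length as \<oplus> eval as x = x [^] (length as - 1) \<otimes> (x \<oplus> b)"
    unfolding as(3)[symmetric] using x bC as(2) nat_pow_Suc[of x "length as - 1"]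
    by (simp add: r_distr del: nat_pow_Suc)
  also have "\<dots> = \<zero>" using x by (simp add: xb)
  finally show ?thesis
    using integral_closure_iff[OF subringE(1,3)[OF A]] as x by blast
qed

text \<open>\<open>C\<close> is a subring of the field that contains \<open>A\<close> and is finitely generated as an \<open>A\<close>-module.
Integral elements are handled through such \<open>C\<close>: all their elements are integral over \<open>A\<close>, and every
finite set of integral elements lies in one of them.\<close>

definition module_finite :: "'a set \<Rightarrow> 'a set \<Rightarrow> bool" where
  "module_finite A C \<longleftrightarrow>
     subring C R \<and> A \<subseteq> C \<and> (\<exists>cs. set cs \<subseteq> carrier R \<and> C = Span A cs)"

lemma module_finite_refl:
  assumes "subring A R" shows "module_finite A A"
proof -
  note A = subringE[OF assms]
  have "Span A [\<one>] = A"
    using A(1) by (auto simp: set_eq_iff Span_Cons_iff Span_Nil subset_iff)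
  then show ?thesis unfolding module_finite_def using assms by (intro conjI exI[of _ "[\<one>]"]) auto
qed

lemma module_finite_extend:
  assumes A: "subring A R" and C: "module_finite A C" and x: "x \<in> integral_closure R C"
  shows "\<exists>C'. module_finite A C' \<and> C \<subseteq> C' \<and> x \<in> C'"
proof -
  from C obtain cs where C': "subring C R" "A \<subseteq> C" "set cs \<subseteq> carrier R" "C = Span A cs"
    by (auto simp: module_finite_def)
  from x obtain as where xc: "x \<in> carrier R"
    and as: "set as \<subseteq> C" "x [^] length as \<oplus> eval as x = \<zero>"
    using integral_closure_iff[OF subringE(1,3)[OF C'(1)]] by blast
  have "set (exp_base x (length as)) \<subseteq> carrier R" using xc by (auto simp: set_exp_base)
  then obtain ls where "set ls \<subseteq> carrier R" "Span A ls = simple_extension C x"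
    using Span_trans[OF subringE(1)[OF A] C'(3)] simple_extension_eq_Span[OF C'(1) xc as] C'(4)
    by metis
  moreover have "C \<subseteq> simple_extension C x"
    by (rule simple_extension_incl[OF subringE(1)[OF C'(1)] xc])
  ultimately show ?thesis
    using simple_extension_is_subring[OF C'(1) xc] simple_extension_mem[OF C'(1) xc] C'(2)
    unfolding module_finite_def by blast
qed

lemma finite_integral_subset_module_finite:
  assumes A: "subring A R" and "finite F" "F \<subseteq> integral_closure R A"
  shows "\<exists>C. module_finite A C \<and> F \<subseteq> C"
  using assms(2,3)
proof (induction F)
  case empty
  then show ?case using module_finite_refl[OF A] by auto
next
  case (insert x F)
  then obtain C where C: "module_finite A C" "F \<subseteq> C" by auto
  have "x \<in> integral_closure R C"
    using insert integral_closure_mono[of A C] C by (auto simp: module_finite_def)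
  from module_finite_extend[OF A C(1) this] show ?case using C by blast
qed

lemma module_finite_integral:
  assumes A: "subring A R" and C: "module_finite A C"
  shows "C \<subseteq> integral_closure R A"
proof
  fix x assume x: "x \<in> C"
  from C obtain cs where C': "subring C R" "A \<subseteq> C" "set cs \<subseteq> carrier R" "C = Span A cs"
    by (auto simp: module_finite_def)
  note CC = subringE[OF C'(1)]
  show "x \<in> integral_closure R A"
  proof (rule integral_if_stable[OF A _ C'(3)])
    show "x \<in> carrier R" using x CC by auto
    show "\<not> set cs \<subseteq> {\<zero>}"
      using Span_trivial[OF subringE(1)[OF A], of cs] CC(3) C'(4) one_not_zero by blast
    fix m assume "m \<in> set cs"
    then have "m \<in> C" using Span_gen[OF A C'(3)] C'(4) by simp
    then show "x \<otimes> m \<in> Span A cs" using x CC(6) C'(4) by simp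
  qed
qed

lemma integral_closure_is_subring:
  assumes A: "subring A R" shows "subring (integral_closure R A) R"
proof (rule subringI)
  show sub: "integral_closure R A \<subseteq> carrier R" by (auto simp: integral_closure_def)
  show "\<one> \<in> integral_closure R A"
    using subring_subset_integral_closure[OF A] subringE(3)[OF A] by auto
  fix x y assume xy: "x \<in> integral_closure R A" "y \<in> integral_closure R A"
  then have "{x, y} \<subseteq> integral_closure R A" by simp
  then obtain C where C: "module_finite A C" "{x, y} \<subseteq> C"
    using finite_integral_subset_module_finite[OF A, of "{x, y}"] by blast
  then have "subring C R" "C \<subseteq> integral_closure R A" "x \<in> C" "y \<in> C"
    using module_finite_integral[OF A C(1)] by (auto simp: module_finite_def)
  then show "x \<otimes> y \<in> integral_closure R A" "x \<oplus> y \<in> integral_closure R A"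
    using subringE(6,7)[of C R] by auto
next
  fix x assume "x \<in> integral_closure R A"
  then obtain C where C: "module_finite A C" "{x} \<subseteq> C"
    using finite_integral_subset_module_finite[OF A, of "{x}"] by blast
  then show "\<ominus> x \<in> integral_closure R A"
    using module_finite_integral[OF A C(1)] subringE(5)[of C R x] by (auto simp: module_finite_def)
qed

lemma integral_closure_idem:
  assumes A: "subring A R"
  shows "integral_closure R (integral_closure R A) = integral_closure R A"
proof
  define D where "D = integral_closure R A"
  have D: "subring D R" unfolding D_def by (rule integral_closure_is_subring[OF A])
  show "integral_closure R (integral_closure R A) \<subseteq> integral_closure R A"
  proof
    fix x assume "x \<in> integral_closure R (integral_closure R A)"
    then obtain as where x: "x \<in> carrier R"
      and as: "set as \<subseteq> D" "x [^] length as \<oplus> eval as x = \<zero>"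
      using integral_closure_iff[OF subringE(1,3)[OF D]] by (auto simp: D_def)
    obtain C where C: "module_finite A C" "set as \<subseteq> C"
      using finite_integral_subset_module_finite[OF A, of "set as"] as by (auto simp: D_def)
    then have CC: "subring C R" by (simp add: module_finite_def)
    have "x \<in> integral_closure R C"
      using integral_closure_iff[OF subringE(1,3)[OF CC]] x as C by blast
    from module_finite_extend[OF A C(1) this] show "x \<in> integral_closure R A"
      using module_finite_integral[OF A] by blast
  qed
  show "integral_closure R A \<subseteq> integral_closure R (integral_closure R A)"
    using subring_subset_integral_closure[OF D] by (simp add: D_def)
qed

end

section \<open>A quartic equation from the Ratliff-Rush property\<close>

context cring
begin

lemma ideal_criterion:
  assumes sub: "I \<subseteq> carrier R" and zero: "\<zero> \<in> I"
    and add: "\<And>a b. a \<in> I \<Longrightarrow> b \<in> I \<Longrightarrow> a \<oplus> b \<in> I"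
    and smult: "\<And>a x. a \<in> I \<Longrightarrow> x \<in> carrier R \<Longrightarrow> x \<otimes> a \<in> I"
  shows "ideal I R"
proof (rule idealI)
  show "subgroup I (add_monoid R)"
  proof (rule add.subgroupI)
    fix a assume a: "a \<in> I"
    then have "\<ominus> a = (\<ominus> \<one>) \<otimes> a" using sub by (auto simp: l_minus)
    then show "\<ominus> a \<in> I" using smult[OF a, of "\<ominus> \<one>"] by simp
  qed (use sub zero add in auto)
  show "\<And>a x. a \<in> I \<Longrightarrow> x \<in> carrier R \<Longrightarrow> a \<otimes> x \<in> I"
    using smult sub m_comm by (metis subsetD)
qed (use smult ring_axioms in auto)

lemma genideal4_subset:
  assumes c: "p \<in> carrier R" "q \<in> carrier R" "r \<in> carrier R" "s \<in> carrier R"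
  shows "Idl {p, q, r, s} \<subseteq> {w \<otimes> p \<oplus> x \<otimes> q \<oplus> y \<otimes> r \<oplus> z \<otimes> s | w x y z.
    w \<in> carrier R \<and> x \<in> carrier R \<and> y \<in> carrier R \<and> z \<in> carrier R}" (is "_ \<subseteq> ?L")
proof (rule genideal_minimal)
  have L: "w \<otimes> p \<oplus> x \<otimes> q \<oplus> y \<otimes> r \<oplus> z \<otimes> s \<in> ?L"
    if "w \<in> carrier R" "x \<in> carrier R" "y \<in> carrier R" "z \<in> carrier R" for w x y z
    using that by blast
  show "ideal ?L R"
  proof (rule ideal_criterion)
    show "\<zero> \<in> ?L" using L[of \<zero> \<zero> \<zero> \<zero>] c by simp
  next
    fix a b assume "a \<in> ?L" "b \<in> ?L"
    then obtain w x y z w' x' y' z' where *: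
      "w \<in> carrier R" "x \<in> carrier R" "y \<in> carrier R" "z \<in> carrier R"
      "w' \<in> carrier R" "x' \<in> carrier R" "y' \<in> carrier R" "z' \<in> carrier R"
      "a = w \<otimes> p \<oplus> x \<otimes> q \<oplus> y \<otimes> r \<oplus> z \<otimes> s" "b = w' \<otimes> p \<oplus> x' \<otimes> q \<oplus> y' \<otimes> r \<oplus> z' \<otimes> s"
      unfolding mem_Collect_eq by (elim exE conjE) (rule that; assumption)
    have "a \<oplus> b = (w \<oplus> w') \<otimes> p \<oplus> (x \<oplus> x') \<otimes> q \<oplus> (y \<oplus> y') \<otimes> r \<oplus> (z \<oplus> z') \<otimes> s"
      unfolding *(9,10) using c *(1-8)
      by (simp add: l_distr a_ac)
    then show "a \<oplus> b \<in> ?L" using L[of "w \<oplus> w'" "x \<oplus> x'" "y \<oplus> y'" "z \<oplus> z'"] * by simp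
  next
    fix a t assume "a \<in> ?L" and t: "t \<in> carrier R"
    then obtain w x y z where *:
      "w \<in> carrier R" "x \<in> carrier R" "y \<in> carrier R" "z \<in> carrier R"
      "a = w \<otimes> p \<oplus> x \<otimes> q \<oplus> y \<otimes> r \<oplus> z \<otimes> s"
      unfolding mem_Collect_eq by (elim exE conjE) (rule that; assumption)
    have "t \<otimes> a = (t \<otimes> w) \<otimes> p \<oplus> (t \<otimes> x) \<otimes> q \<oplus> (t \<otimes> y) \<otimes> r \<oplus> (t \<otimes> z) \<otimes> s"
      unfolding *(5) using c *(1-4) t by algebra
    then show "t \<otimes> a \<in> ?L" using L[of "t \<otimes> w" "t \<otimes> x" "t \<otimes> y" "t \<otimes> z"] * t by simp
  qed (use c in auto)
  show "{p, q, r, s} \<subseteq> ?L"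
    using L[of \<one> \<zero> \<zero> \<zero>] L[of \<zero> \<one> \<zero> \<zero>] L[of \<zero> \<zero> \<one> \<zero>] L[of \<zero> \<zero> \<zero> \<one>] c by auto
qed

lemma ideals_set_pow:
  assumes "ideal I R"
  shows "I [^]\<^bsub>ideals_set R\<^esub> (1::nat) = I" "I [^]\<^bsub>ideals_set R\<^esub> (2::nat) = I \<cdot> I"
proof -
  interpret M: comm_monoid "ideals_set R" by (rule ideals_set_is_comm_monoid)
  have I: "I \<in> carrier (ideals_set R)" using assms by (simp add: ideals_set_def)
  show "I [^]\<^bsub>ideals_set R\<^esub> (1::nat) = I" using I by simp
  have "I [^]\<^bsub>ideals_set R\<^esub> (2::nat) = I \<otimes>\<^bsub>ideals_set R\<^esub> I"
    using I by (simp add: numeral_2_eq_2)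
  then show "I [^]\<^bsub>ideals_set R\<^esub> (2::nat) = I \<cdot> I" by (simp add: ideals_set_def)
qed

text \<open>If \<open>x I \<subseteq> I\<^sup>2\<close>, then \<open>x\<close> is in the Ratliff-Rush closure of \<open>I\<close>; the inclusion is checked on generators.\<close>

lemma mem_ratliff_rush_closure_genideal:
  assumes S: "S \<subseteq> carrier R" and x: "x \<in> carrier R"
    and mult: "\<And>s. s \<in> S \<Longrightarrow> \<exists>i\<in>S. \<exists>j\<in>S. x \<otimes> s = i \<otimes> j"
  shows "x \<in> ratliff_rush_closure R (Idl S)"
proof -
  have I: "ideal (Idl S) R" by (rule genideal_ideal[OF S])
  have II: "ideal ((Idl S) \<cdot> (Idl S)) R" by (rule ideal_prod_is_ideal[OF I I])
  have "ideal {w \<in> carrier R. x \<otimes> w \<in> (Idl S) \<cdot> (Idl S)} R"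
  proof (rule ideal_criterion)
    fix a b assume "a \<in> {w \<in> carrier R. x \<otimes> w \<in> (Idl S) \<cdot> (Idl S)}" "b \<in> {w \<in> carrier R. x \<otimes> w \<in> (Idl S) \<cdot> (Idl S)}"
    then show "a \<oplus> b \<in> {w \<in> carrier R. x \<otimes> w \<in> (Idl S) \<cdot> (Idl S)}"
      using x additive_subgroup.a_closed[OF ideal.axioms(1)[OF II]] by (simp add: r_distr)
  next
    fix a t assume "a \<in> {w \<in> carrier R. x \<otimes> w \<in> (Idl S) \<cdot> (Idl S)}" "t \<in> carrier R"
    then show "t \<otimes> a \<in> {w \<in> carrier R. x \<otimes> w \<in> (Idl S) \<cdot> (Idl S)}"
      using x ideal.I_l_closed[OF II] by (simp add: m_lcomm)
  qed (use x additive_subgroup.zero_closed[OF ideal.axioms(1)[OF II]] in auto)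
  then have "Idl S \<subseteq> {w \<in> carrier R. x \<otimes> w \<in> (Idl S) \<cdot> (Idl S)}"
  proof (rule genideal_minimal)
    show "S \<subseteq> {w \<in> carrier R. x \<otimes> w \<in> (Idl S) \<cdot> (Idl S)}"
    proof safe
      fix s assume s: "s \<in> S"
      then show "s \<in> carrier R" using S by auto
      from mult[OF s] obtain i j where "i \<in> S" "j \<in> S" "x \<otimes> s = i \<otimes> j" by auto
      then show "x \<otimes> s \<in> (Idl S) \<cdot> (Idl S)"
        using genideal_self[OF S] by (auto intro: ideal_prod.prod)
    qed
  qed
  then have "x \<in> colon_ideal R ((Idl S) [^]\<^bsub>ideals_set R\<^esub> (1 + 1 :: nat)) ((Idl S) [^]\<^bsub>ideals_set R\<^esub> (1::nat))"
    unfolding colon_ideal_def one_add_one ideals_set_pow[OF I] using x by auto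
  then show ?thesis unfolding ratliff_rush_closure_def by blast
qed

end

lemma (in domain) ratliff_rush_quartic:
  assumes closed: "\<forall>I. fg_ideal R I \<longrightarrow> I \<noteq> {\<zero>} \<longrightarrow> ratliff_rush_closure R I = I"
    and a: "a \<in> carrier R" "a \<noteq> \<zero>" and b: "b \<in> carrier R"
  shows "\<exists>w x y z. (a \<otimes> a) \<otimes> (b \<otimes> b) = w \<otimes> ((a \<otimes> a) \<otimes> (a \<otimes> a)) \<oplus> x \<otimes> ((a \<otimes> a) \<otimes> (a \<otimes> b)) \<oplus>
      y \<otimes> ((a \<otimes> b) \<otimes> (b \<otimes> b)) \<oplus> z \<otimes> ((b \<otimes> b) \<otimes> (b \<otimes> b)) \<and>
    w \<in> carrier R \<and> x \<in> carrier R \<and> y \<in> carrier R \<and> z \<in> carrier R"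
proof -
  let ?p = "(a \<otimes> a) \<otimes> (a \<otimes> a)" and ?q = "(a \<otimes> a) \<otimes> (a \<otimes> b)"
    and ?r = "(a \<otimes> b) \<otimes> (b \<otimes> b)" and ?s = "(b \<otimes> b) \<otimes> (b \<otimes> b)"
  let ?S = "{?p, ?q, ?r, ?s}"
  have S: "?S \<subseteq> carrier R" using a b by simp
  have fg: "fg_ideal R (Idl ?S)"
    unfolding fg_ideal_def by (rule exI[of _ ?S]) (use S in simp)
  have "?p \<noteq> \<zero>" using a by (simp add: integral_iff)
  then have "Idl ?S \<noteq> {\<zero>}" using genideal_self[OF S] by auto
  then have "ratliff_rush_closure R (Idl ?S) = Idl ?S"
    by (rule closed[rule_format, OF fg])
  moreover have "(a \<otimes> a) \<otimes> (b \<otimes> b) \<in> ratliff_rush_closure R (Idl ?S)"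
  proof (rule mem_ratliff_rush_closure_genideal[OF S])
    fix s assume "s \<in> ?S"
    then consider "s = ?p" | "s = ?q" | "s = ?r" | "s = ?s" by blast
    then show "\<exists>i\<in>?S. \<exists>j\<in>?S. (a \<otimes> a) \<otimes> (b \<otimes> b) \<otimes> s = i \<otimes> j"
    proof cases
      case 1
      then have "(a \<otimes> a) \<otimes> (b \<otimes> b) \<otimes> s = ?q \<otimes> ?q" using a b by (simp add: m_ac)
      then show ?thesis by blast
    next
      case 2
      then have "(a \<otimes> a) \<otimes> (b \<otimes> b) \<otimes> s = ?p \<otimes> ?r" using a b by (simp add: m_ac)
      then show ?thesis by blast
    next
      case 3
      then have "(a \<otimes> a) \<otimes> (b \<otimes> b) \<otimes> s = ?q \<otimes> ?s" using a b by (simp add: m_ac)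
      then show ?thesis by blast
    next
      case 4
      then have "(a \<otimes> a) \<otimes> (b \<otimes> b) \<otimes> s = ?r \<otimes> ?r" using a b by (simp add: m_ac)
      then show ?thesis by blast
    qed
  qed (use a b in simp)
  ultimately have "(a \<otimes> a) \<otimes> (b \<otimes> b) \<in> Idl ?S" by simp
  then show ?thesis
    by (intro CollectD[OF subsetD[OF genideal4_subset]]) (use a b in simp_all)
qed

lemma (in field) quartic_dehomogenize:
  assumes c: "c \<in> carrier R" and v: "v \<in> carrier R" "v \<noteq> \<zero>"
    and C: "w \<in> carrier R" "x \<in> carrier R" "y \<in> carrier R" "z \<in> carrier R"
    and eq: "(c \<otimes> c) \<otimes> (v \<otimes> v) = w \<otimes> ((c \<otimes> c) \<otimes> (c \<otimes> c)) \<oplus> x \<otimes> ((c \<otimes> c) \<otimes> (c \<otimes> v)) \<oplus>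
      y \<otimes> ((c \<otimes> v) \<otimes> (v \<otimes> v)) \<oplus> z \<otimes> ((v \<otimes> v) \<otimes> (v \<otimes> v))"
    and u: "u = c \<otimes> inv v"
  shows "u \<otimes> u = w \<otimes> (u \<otimes> u \<otimes> u \<otimes> u) \<oplus> x \<otimes> (u \<otimes> u \<otimes> u) \<oplus> y \<otimes> u \<oplus> z"
proof -
  have i: "inv v \<in> carrier R" "inv v \<otimes> v = \<one>"
    using v by (simp_all add: field_Units)
  have uc: "u \<in> carrier R" using u c i by simp
  have cu: "c = u \<otimes> v" using u c v i by (simp add: m_assoc)
  let ?v4 = "v \<otimes> v \<otimes> v \<otimes> v"
  have v4: "?v4 \<in> carrier R" "?v4 \<noteq> \<zero>" using v by (simp_all add: integral_iff)
  have "?v4 \<otimes> (u \<otimes> u) = (c \<otimes> c) \<otimes> (v \<otimes> v)"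
    unfolding cu using uc v by (simp add: m_ac)
  also have "\<dots> = ?v4 \<otimes> (w \<otimes> (u \<otimes> u \<otimes> u \<otimes> u) \<oplus> x \<otimes> (u \<otimes> u \<otimes> u) \<oplus> y \<otimes> u \<oplus> z)"
    unfolding eq unfolding cu using uc v C by (simp add: m_ac r_distr)
  finally show ?thesis
    using v4 uc C m_lcancel[OF v4(2,1)] by simp
qed

text \<open>The equation is \<open>f(u) = 0\<close> for \<open>f = w X\<^sup>4 + x X\<^sup>3 - X\<^sup>2 + y X + z\<close>. If a polynomial of degree \<open>n\<close>
over \<open>D\<close> with leading coefficient \<open>c\<close> vanishes at \<open>u\<close>, then multiplying by \<open>c\<^bsup>n-1\<^esup>\<close> shows that \<open>c u\<close> is
integral over \<open>D\<close>, hence in \<open>D\<close>; so the two leading terms can be contracted to a single term of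
degree \<open>n - 1\<close> with coefficient in \<open>D\<close>. The conclusion is reached once the coefficient \<open>-1\<close> has been absorbed.\<close>

lemma (in domain) quartic_unit_coefficient:
  assumes D: "subring D R" and closed: "integral_closure R D \<subseteq> D"
    and u: "u \<in> carrier R"
    and c: "w \<in> D" "x \<in> D" "y \<in> D" "z \<in> D"
    and eq: "u \<otimes> u = w \<otimes> (u \<otimes> u \<otimes> u \<otimes> u) \<oplus> x \<otimes> (u \<otimes> u \<otimes> u) \<oplus> y \<otimes> u \<oplus> z"
  shows "\<exists>p\<in>D. \<exists>q\<in>D. p \<otimes> u \<in> D \<and> q \<otimes> u \<in> D \<and> p \<otimes> u \<ominus> q = \<one>"
proof -
  note DD = subringE[OF D]
  note C = c[THEN subsetD[OF DD(1)]]
  have int: "t \<in> D" if "t \<in> carrier R" "set as \<subseteq> D" "t [^] length as \<oplus> eval as t = \<zero>" for t as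
    using closed integral_closure_iff[OF DD(1,3)] that by blast
  \<comment> \<open>\<open>f\<close> is the value at \<open>u\<close> of the polynomial; it is rewritten below after each contraction.\<close>
  define f where "f = w \<otimes> (u \<otimes> u \<otimes> u \<otimes> u) \<oplus> x \<otimes> (u \<otimes> u \<otimes> u) \<ominus> u \<otimes> u \<oplus> y \<otimes> u \<oplus> z"
  have f: "f = \<zero>"
  proof -
    have "f = (w \<otimes> (u \<otimes> u \<otimes> u \<otimes> u) \<oplus> x \<otimes> (u \<otimes> u \<otimes> u) \<oplus> y \<otimes> u \<oplus> z) \<ominus> u \<otimes> u"
      unfolding f_def using C u by algebra
    then show ?thesis unfolding eq[symmetric] using u by (simp add: a_minus_def r_neg)
  qed
  have wu: "w \<otimes> u \<in> D"
  proof (rule int)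
    let ?as = "[x, \<ominus> w, w \<otimes> w \<otimes> y, w \<otimes> w \<otimes> w \<otimes> z]"
    show "set ?as \<subseteq> D" using c DD by auto
    have "(w \<otimes> u) [^] length ?as \<oplus> eval ?as (w \<otimes> u) = w \<otimes> w \<otimes> w \<otimes> f"
      unfolding f_def using C u by (simp, algebra)
    then show "(w \<otimes> u) [^] length ?as \<oplus> eval ?as (w \<otimes> u) = \<zero>" using f C by simp
  qed (use C u in simp)
  define p where "p = w \<otimes> u \<oplus> x"
  have pD: "p \<in> D" unfolding p_def using wu c DD by auto
  have p: "p \<in> carrier R" using pD DD by auto
  have fp: "f = p \<otimes> (u \<otimes> u \<otimes> u) \<ominus> u \<otimes> u \<oplus> y \<otimes> u \<oplus> z"
    unfolding f_def p_def using C u by algebra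
  have pu: "p \<otimes> u \<in> D"
  proof (rule int)
    let ?as = "[\<ominus> \<one>, p \<otimes> y, p \<otimes> p \<otimes> z]"
    show "set ?as \<subseteq> D" using pD c DD by auto
    have "(p \<otimes> u) [^] length ?as \<oplus> eval ?as (p \<otimes> u) = p \<otimes> p \<otimes> f"
      unfolding fp using p C u by (simp, algebra)
    then show "(p \<otimes> u) [^] length ?as \<oplus> eval ?as (p \<otimes> u) = \<zero>" using f p by simp
  qed (use p u in simp)
  define q where "q = p \<otimes> u \<ominus> \<one>"
  have qD: "q \<in> D" unfolding q_def using pu DD by (auto simp: a_minus_def)
  have q: "q \<in> carrier R" using qD DD by auto
  have fq: "f = q \<otimes> (u \<otimes> u) \<oplus> y \<otimes> u \<oplus> z"
    unfolding fp q_def using p C u by algebra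
  have qu: "q \<otimes> u \<in> D"
  proof (rule int)
    let ?as = "[y, q \<otimes> z]"
    show "set ?as \<subseteq> D" using qD c DD by auto
    have "(q \<otimes> u) [^] length ?as \<oplus> eval ?as (q \<otimes> u) = q \<otimes> f"
      unfolding fq using q C u by (simp, algebra)
    then show "(q \<otimes> u) [^] length ?as \<oplus> eval ?as (q \<otimes> u) = \<zero>" using f q by simp
  qed (use q u in simp)
  have "p \<otimes> u \<ominus> q = \<one>" unfolding q_def using p u by algebra
  with pD qD pu qu show ?thesis by blast
qed

section \<open>Invertibility of finitely generated ideals\<close>

context field
begin

text \<open>The fractional ideal \<open>(D : I)\<close> of all \<open>x\<close> in the ambient field with \<open>xI \<subseteq> D\<close>, the only possible inverse of \<open>I\<close>.\<close>

definition inverse_ideal :: "'a set \<Rightarrow> 'a set \<Rightarrow> 'a set" where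
  "inverse_ideal D I = {x \<in> carrier R. \<forall>w\<in>I. x \<otimes> w \<in> D}"

lemma inverse_ideal_genideal:
  assumes D: "subring D R" and S: "S \<subseteq> D" and x: "x \<in> carrier R"
    and gen: "\<And>s. s \<in> S \<Longrightarrow> x \<otimes> s \<in> D"
  shows "x \<in> inverse_ideal D (Idl\<^bsub>R\<lparr>carrier := D\<rparr>\<^esub> S)"
proof -
  note DD = subringE[OF D]
  interpret D: domain "R\<lparr>carrier := D\<rparr>" by (rule subring_is_domain[OF D])
  have "ideal {w \<in> D. x \<otimes> w \<in> D} (R\<lparr>carrier := D\<rparr>)"
  proof (rule D.ideal_criterion, goal_cases)
    case (3 a b)
    then have "x \<otimes> (a \<oplus> b) = x \<otimes> a \<oplus> x \<otimes> b" using DD(1) x by (auto simp: r_distr subset_iff)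
    then show ?case using 3 DD by simp
  next
    case (4 a y)
    then have "x \<otimes> (y \<otimes> a) = y \<otimes> (x \<otimes> a)" using DD(1) x by (auto intro!: m_lcomm)
    then show ?case using 4 DD by simp
  qed (use DD x in auto)
  then have "Idl\<^bsub>R\<lparr>carrier := D\<rparr>\<^esub> S \<subseteq> {w \<in> D. x \<otimes> w \<in> D}"
    by (rule D.genideal_minimal) (use S gen in auto)
  then show ?thesis using x by (auto simp: inverse_ideal_def)
qed

lemma fractional_ideal_inverse_ideal:
  assumes D: "subring D R" and m: "m \<in> I" "m \<in> D" "m \<noteq> \<zero>" and I: "I \<subseteq> D"
  shows "fractional_ideal R D (inverse_ideal D I)"
  unfolding fractional_ideal_def
proof (intro conjI ballI)
  note DD = subringE[OF D]
  have IC: "I \<subseteq> carrier R" using I DD(1) by auto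
  show "additive_subgroup (inverse_ideal D I) R"
  proof (rule additive_subgroupI, rule add.subgroupI)
    show "inverse_ideal D I \<subseteq> carrier R" by (auto simp: inverse_ideal_def)
    show "inverse_ideal D I \<noteq> {}"
      using DD(2) IC by (auto simp: inverse_ideal_def intro!: exI[of _ \<zero>])
  next
    fix x assume x: "x \<in> inverse_ideal D I"
    then show "\<ominus> x \<in> inverse_ideal D I"
      using DD(5) IC by (auto simp: inverse_ideal_def l_minus)
    fix y assume "y \<in> inverse_ideal D I"
    with x show "x \<oplus> y \<in> inverse_ideal D I"
      using DD(7) IC by (auto simp: inverse_ideal_def l_distr subset_iff)
  qed
  show "d \<otimes> x \<in> inverse_ideal D I" if "d \<in> D" "x \<in> inverse_ideal D I" for d x
    using that DD IC by (auto simp: inverse_ideal_def m_assoc subset_iff)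
  show "\<exists>d\<in>D - {\<zero>}. \<forall>x\<in>inverse_ideal D I. d \<otimes> x \<in> D"
  proof (rule bexI[of _ m], rule ballI)
    fix x assume x: "x \<in> inverse_ideal D I"
    then have "m \<otimes> x = x \<otimes> m" using m IC by (auto simp: inverse_ideal_def m_comm)
    then show "m \<otimes> x \<in> D" using x m by (auto simp: inverse_ideal_def)
  qed (use m in auto)
qed

text \<open>The assumption \<open>pairs\<close> expresses that the ideals generated by two elements, one of them nonzero,
are invertible; \<open>q\<close> and \<open>s\<close> are elements of the inverse ideal. In the
induction step, let \<open>I\<close> be generated by \<open>S\<close>, let \<open>a \<in> I\<close> and \<open>p \<in> (D : I)\<close>, and take \<open>q\<close> and \<open>s\<close> for
the pair \<open>a, b\<close>. Then \<open>ap = a(paq) + b(pas)\<close>, where \<open>paq\<close> and \<open>pas\<close> multiply both \<open>I\<close> and \<open>b\<close> into \<open>D\<close>.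
So the product for \<open>insert b S\<close> contains the one for \<open>S\<close>, and in particular \<open>1\<close>.\<close>

lemma one_mem_prod_inverse_ideal:
  assumes D: "subring D R"
    and pairs: "\<And>a b. a \<in> D \<Longrightarrow> b \<in> D \<Longrightarrow> a \<noteq> \<zero> \<Longrightarrow>
      \<exists>q\<in>carrier R. \<exists>s\<in>carrier R. q \<otimes> a \<oplus> s \<otimes> b = \<one> \<and>
        q \<otimes> a \<in> D \<and> q \<otimes> b \<in> D \<and> s \<otimes> a \<in> D \<and> s \<otimes> b \<in> D"
    and S: "finite S" "S \<subseteq> D" "\<not> S \<subseteq> {\<zero>}"
  shows "\<one> \<in> ideal_prod R (Idl\<^bsub>R\<lparr>carrier := D\<rparr>\<^esub> S) (inverse_ideal D (Idl\<^bsub>R\<lparr>carrier := D\<rparr>\<^esub> S))"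
  using S
proof (induction S rule: finite_induct)
  case (insert b S)
  note DD = subringE[OF D]
  interpret D: domain "R\<lparr>carrier := D\<rparr>" by (rule subring_is_domain[OF D])
  let ?Idl = "genideal (R\<lparr>carrier := D\<rparr>)"
  let ?J = "inverse_ideal D"
  have bD: "b \<in> D" and SD: "S \<subseteq> D" using insert by auto
  have b: "b \<in> carrier R" using bD DD by auto
  have T: "insert b S \<subseteq> ?Idl (insert b S)" using D.genideal_self[of "insert b S"] insert by simp
  have sub: "?Idl S \<subseteq> ?Idl (insert b S)"
    using D.genideal_minimal[OF D.genideal_ideal, of "insert b S" S] T insert by simp
  have ID: "?Idl S \<subseteq> D"
    using D.genideal_minimal[OF D.oneideal, of S] SD by simp
  have SI: "S \<subseteq> ?Idl S" using D.genideal_self[of S] SD by simp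
  show ?case
  proof (cases "S \<subseteq> {\<zero>}")
    case True
    then have b0: "b \<noteq> \<zero>" using insert by auto
    then have ib: "inv b \<in> carrier R" "b \<otimes> inv b = \<one>" "inv b \<otimes> b = \<one>"
      using b by (simp_all add: field_Units)
    have "inv b \<in> ?J (?Idl (insert b S))"
      by (rule inverse_ideal_genideal[OF D]) (use insert ib True DD in auto)
    then have "b \<otimes> inv b \<in> ideal_prod R (?Idl (insert b S)) (?J (?Idl (insert b S)))"
      using T by (intro ideal_prod.prod) auto
    then show ?thesis using ib by simp
  next
    case False
    then have IH: "\<one> \<in> ideal_prod R (?Idl S) (?J (?Idl S))" using insert by auto
    have key: "a \<otimes> p \<in> ideal_prod R (?Idl (insert b S)) (?J (?Idl (insert b S)))"
      if a: "a \<in> ?Idl S" and p: "p \<in> ?J (?Idl S)" for a p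
    proof (cases "a = \<zero>")
      case True
      have "\<zero> \<in> ?J (?Idl (insert b S))"
        by (rule inverse_ideal_genideal[OF D]) (use insert DD in auto)
      then have "a \<otimes> \<zero> \<in> ideal_prod R (?Idl (insert b S)) (?J (?Idl (insert b S)))"
        using a sub by (intro ideal_prod.prod) auto
      then show ?thesis using True p by (simp add: inverse_ideal_def)
    next
      case False
      have aD: "a \<in> D" using a ID by auto
      obtain q s where qs: "q \<in> carrier R" "s \<in> carrier R" "q \<otimes> a \<oplus> s \<otimes> b = \<one>"
        "q \<otimes> a \<in> D" "q \<otimes> b \<in> D" "s \<otimes> a \<in> D" "s \<otimes> b \<in> D"
        using pairs[OF aD bD False] by auto
      have ac: "a \<in> carrier R" and pc: "p \<in> carrier R"
        using aD DD(1) p by (auto simp: inverse_ideal_def)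
      have pw: "p \<otimes> w \<in> D" if "w \<in> ?Idl S" for w
        using p that by (auto simp: inverse_ideal_def)
      have prod: "v \<in> D" if "x \<in> D" "y \<in> D" "v = x \<otimes> y" for v x y using that DD(6) by simp
      have 1: "p \<otimes> a \<otimes> q \<in> ?J (?Idl (insert b S))"
      proof (rule inverse_ideal_genideal[OF D])
        fix t assume "t \<in> insert b S"
        then consider "t = b" | "t \<in> S" "t \<in> carrier R" using SD DD(1) by auto
        then show "p \<otimes> a \<otimes> q \<otimes> t \<in> D"
        proof cases
          case 1
          show ?thesis
            by (rule prod[OF pw[OF a] qs(5)]) (use 1 ac pc b qs in \<open>simp add: m_ac\<close>)
        next
          case 2
          show ?thesis
            by (rule prod[OF pw[of t] qs(4)]) (use 2 SI ac pc b qs in \<open>auto simp add: m_ac\<close>)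
        qed
      qed (use insert ac pc qs in auto)
      have 2: "p \<otimes> a \<otimes> s \<in> ?J (?Idl (insert b S))"
      proof (rule inverse_ideal_genideal[OF D])
        fix t assume "t \<in> insert b S"
        then consider "t = b" | "t \<in> S" "t \<in> carrier R" using SD DD(1) by auto
        then show "p \<otimes> a \<otimes> s \<otimes> t \<in> D"
        proof cases
          case 1
          show ?thesis
            by (rule prod[OF pw[OF a] qs(7)]) (use 1 ac pc b qs in \<open>simp add: m_ac\<close>)
        next
          case 2
          show ?thesis
            by (rule prod[OF pw[of t] qs(6)]) (use 2 SI ac pc b qs in \<open>auto simp add: m_ac\<close>)
        qed
      qed (use insert ac pc qs in auto)
      have "a \<otimes> p = (a \<otimes> p) \<otimes> (q \<otimes> a \<oplus> s \<otimes> b)" using qs(3) ac pc by simp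
      also have "\<dots> = a \<otimes> (p \<otimes> a \<otimes> q) \<oplus> b \<otimes> (p \<otimes> a \<otimes> s)"
        using ac pc b qs(1,2) by algebra
      also have "\<dots> \<in> ideal_prod R (?Idl (insert b S)) (?J (?Idl (insert b S)))"
        using 1 2 a sub T by (intro ideal_prod.sum ideal_prod.prod) auto
      finally show ?thesis .
    qed
    from IH show ?thesis
      by (induction rule: ideal_prod.induct) (auto intro: key ideal_prod.sum)
  qed
qed simp

lemma prufer_domainI:
  assumes D: "subring D R"
    and quot: "\<And>x. x \<in> carrier R \<Longrightarrow> \<exists>a\<in>D. \<exists>b\<in>D - {\<zero>}. x = a \<otimes> inv b"
    and pairs: "\<And>a b. a \<in> D \<Longrightarrow> b \<in> D \<Longrightarrow> a \<noteq> \<zero> \<Longrightarrow>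
      \<exists>q\<in>carrier R. \<exists>s\<in>carrier R. q \<otimes> a \<oplus> s \<otimes> b = \<one> \<and>
        q \<otimes> a \<in> D \<and> q \<otimes> b \<in> D \<and> s \<otimes> a \<in> D \<and> s \<otimes> b \<in> D"
  shows "prufer_domain R D"
  unfolding prufer_domain_def
proof (intro conjI allI impI)
  note DD = subringE[OF D]
  interpret D: domain "R\<lparr>carrier := D\<rparr>" by (rule subring_is_domain[OF D])
  show "subdomain D R" by (rule subdomainI'[OF D])
  show "is_quotient_field (R\<lparr>carrier := D\<rparr>) R id"
    unfolding is_quotient_field_def
    using field_axioms DD(1) quot by (auto simp: ring_hom_def)
  fix I assume I: "fg_ideal (R\<lparr>carrier := D\<rparr>) I \<and> I \<noteq> {\<zero>}"
  then obtain S where S: "finite S" "S \<subseteq> D" "I = Idl\<^bsub>R\<lparr>carrier := D\<rparr>\<^esub> S"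
    unfolding fg_ideal_def by auto
  have SI: "S \<subseteq> I" unfolding S(3) using S(2) by (intro D.genideal_self) simp
  have idI: "ideal I (R\<lparr>carrier := D\<rparr>)" unfolding S(3) using S(2) by (intro D.genideal_ideal) simp
  have ID: "I \<subseteq> D" using D.genideal_minimal[OF D.oneideal, of S] S by simp
  have "\<not> S \<subseteq> {\<zero>}"
  proof
    assume "S \<subseteq> {\<zero>}"
    then have "I \<subseteq> {\<zero>}" unfolding S(3) using D.genideal_minimal[OF D.zeroideal, of S] by simp
    moreover have "\<zero> \<in> I"
      using additive_subgroup.zero_closed[OF ideal.axioms(1)[OF idI]] by simp
    ultimately show False using I by auto
  qed
  then obtain m where m: "m \<in> S" "m \<noteq> \<zero>" by auto
  let ?J = "inverse_ideal D I"
  have one: "\<one> \<in> ideal_prod R I ?J"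
    unfolding S(3) by (rule one_mem_prod_inverse_ideal[OF D pairs S(1,2) \<open>\<not> S \<subseteq> {\<zero>}\<close>])
  have "ideal_prod R I ?J \<subseteq> D"
  proof
    fix x assume "x \<in> ideal_prod R I ?J"
    then show "x \<in> D"
    proof (induction rule: ideal_prod.induct)
      case (prod i j)
      then have "i \<otimes> j = j \<otimes> i" using ID DD(1) by (intro m_comm) (auto simp: inverse_ideal_def)
      then show ?case using prod by (auto simp: inverse_ideal_def)
    qed (use DD(7) in auto)
  qed
  moreover have "D \<subseteq> ideal_prod R I ?J"
  proof
    fix d assume d: "d \<in> D"
    have "x \<in> carrier R \<and> d \<otimes> x \<in> ideal_prod R I ?J" if "x \<in> ideal_prod R I ?J" for x
      using that
    proof (induction rule: ideal_prod.induct)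
      case (prod i j)
      then have c: "i \<in> carrier R" "j \<in> carrier R" "d \<in> carrier R"
        using ID DD(1) d by (auto simp: inverse_ideal_def)
      have "d \<otimes> i \<in> I" using ideal.I_l_closed[OF idI prod(1)] d by simp
      then have "(d \<otimes> i) \<otimes> j \<in> ideal_prod R I ?J" using prod(2) by (rule ideal_prod.prod)
      then show ?case using c by (simp add: m_assoc)
    next
      case (sum x y)
      moreover have "d \<in> carrier R" using d DD by auto
      ultimately show ?case by (auto simp: r_distr intro: ideal_prod.sum)
    qed
    from this[OF one] show "d \<in> ideal_prod R I ?J" using d DD(1) by auto
  qed
  ultimately show "invertible_ideal R D I"
    unfolding invertible_ideal_def
    using fractional_ideal_inverse_ideal[OF D, of m I] m SI ID by blast
qed

end

theorem lemma2p4: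
  fixes R :: "('a, 'm) ring_scheme" and K :: "('b, 'n) ring_scheme" and \<phi> :: "'a \<Rightarrow> 'b"
  assumes "domain R"
    and "is_quotient_field R K \<phi>"
    and "\<And>I. fg_ideal R I \<Longrightarrow> I \<noteq> {\<zero>\<^bsub>R\<^esub>} \<Longrightarrow> ratliff_rush_closure R I = I"
  shows "prufer_domain K (integral_closure K (\<phi> ` carrier R))"
proof -
  interpret R: domain R by (rule assms(1))
  interpret K: field K using assms(2) by (simp add: is_quotient_field_def)
  have hom: "\<phi> \<in> ring_hom R K" and inj: "inj_on \<phi> (carrier R)"
    and frac: "\<And>x. x \<in> carrier K \<Longrightarrow> \<exists>a\<in>carrier R. \<exists>b\<in>carrier R - {\<zero>\<^bsub>R\<^esub>}.
        x = \<phi> a \<otimes>\<^bsub>K\<^esub> inv\<^bsub>K\<^esub> (\<phi> b)"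
    using assms(2) by (simp_all add: is_quotient_field_def)
  interpret h: ring_hom_ring R K \<phi>
    by (rule ring_hom_ringI2[OF R.ring_axioms K.ring_axioms hom])
  define A where "A = \<phi> ` carrier R"
  have A: "subring A K"
    unfolding A_def by (rule h.img_is_subring[OF R.carrier_is_subring])
  define D where "D = integral_closure K A"
  have D: "subring D K" unfolding D_def by (rule K.integral_closure_is_subring[OF A])
  note DD = subringE[OF D]
  have closed: "integral_closure K D \<subseteq> D"
    unfolding D_def K.integral_closure_idem[OF A] ..
  have AD: "A \<subseteq> D" unfolding D_def by (rule K.subring_subset_integral_closure[OF A])
  have nz: "\<phi> b \<noteq> \<zero>\<^bsub>K\<^esub>" if "b \<in> carrier R" "b \<noteq> \<zero>\<^bsub>R\<^esub>" for b
    using that inj_onD[OF inj, of b "\<zero>\<^bsub>R\<^esub>"] h.hom_zero by auto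
  have closedR: "\<forall>I. fg_ideal R I \<longrightarrow> I \<noteq> {\<zero>\<^bsub>R\<^esub>} \<longrightarrow> ratliff_rush_closure R I = I"
    using assms(3) by blast
  have unit_quartic: "\<exists>w\<in>A. \<exists>x\<in>A. \<exists>y\<in>A. \<exists>z\<in>A.
      u \<otimes>\<^bsub>K\<^esub> u = w \<otimes>\<^bsub>K\<^esub> (u \<otimes>\<^bsub>K\<^esub> u \<otimes>\<^bsub>K\<^esub> u \<otimes>\<^bsub>K\<^esub> u) \<oplus>\<^bsub>K\<^esub> x \<otimes>\<^bsub>K\<^esub> (u \<otimes>\<^bsub>K\<^esub> u \<otimes>\<^bsub>K\<^esub> u) \<oplus>\<^bsub>K\<^esub>
        y \<otimes>\<^bsub>K\<^esub> u \<oplus>\<^bsub>K\<^esub> z"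
    if u: "u \<in> carrier K" "u \<noteq> \<zero>\<^bsub>K\<^esub>" for u
  proof -
    from frac[OF u(1)] obtain a b where ab: "a \<in> carrier R" "b \<in> carrier R" "b \<noteq> \<zero>\<^bsub>R\<^esub>"
      "u = \<phi> a \<otimes>\<^bsub>K\<^esub> inv\<^bsub>K\<^esub> (\<phi> b)" by blast
    have pb: "\<phi> b \<in> carrier K" "\<phi> b \<noteq> \<zero>\<^bsub>K\<^esub>" using ab nz by auto
    have "a \<noteq> \<zero>\<^bsub>R\<^esub>"
    proof
      assume "a = \<zero>\<^bsub>R\<^esub>"
      then have "u = \<zero>\<^bsub>K\<^esub>" using ab(4) pb by (simp add: K.field_Units)
      then show False using u by simp
    qed
    from R.ratliff_rush_quartic[OF closedR ab(1) this ab(2)]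
    obtain w x y z where eq: "(a \<otimes>\<^bsub>R\<^esub> a) \<otimes>\<^bsub>R\<^esub> (b \<otimes>\<^bsub>R\<^esub> b) =
        w \<otimes>\<^bsub>R\<^esub> ((a \<otimes>\<^bsub>R\<^esub> a) \<otimes>\<^bsub>R\<^esub> (a \<otimes>\<^bsub>R\<^esub> a)) \<oplus>\<^bsub>R\<^esub> x \<otimes>\<^bsub>R\<^esub> ((a \<otimes>\<^bsub>R\<^esub> a) \<otimes>\<^bsub>R\<^esub> (a \<otimes>\<^bsub>R\<^esub> b)) \<oplus>\<^bsub>R\<^esub>
        y \<otimes>\<^bsub>R\<^esub> ((a \<otimes>\<^bsub>R\<^esub> b) \<otimes>\<^bsub>R\<^esub> (b \<otimes>\<^bsub>R\<^esub> b)) \<oplus>\<^bsub>R\<^esub> z \<otimes>\<^bsub>R\<^esub> ((b \<otimes>\<^bsub>R\<^esub> b) \<otimes>\<^bsub>R\<^esub> (b \<otimes>\<^bsub>R\<^esub> b))"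
      and wc: "w \<in> carrier R" "x \<in> carrier R" "y \<in> carrier R" "z \<in> carrier R"
      by (elim exE conjE) (rule that; assumption)
    have "u \<otimes>\<^bsub>K\<^esub> u = \<phi> w \<otimes>\<^bsub>K\<^esub> (u \<otimes>\<^bsub>K\<^esub> u \<otimes>\<^bsub>K\<^esub> u \<otimes>\<^bsub>K\<^esub> u) \<oplus>\<^bsub>K\<^esub> \<phi> x \<otimes>\<^bsub>K\<^esub> (u \<otimes>\<^bsub>K\<^esub> u \<otimes>\<^bsub>K\<^esub> u) \<oplus>\<^bsub>K\<^esub>
        \<phi> y \<otimes>\<^bsub>K\<^esub> u \<oplus>\<^bsub>K\<^esub> \<phi> z"
    proof (rule K.quartic_dehomogenize[OF _ pb _ _ _ _ _ ab(4)])
      show "\<phi> a \<otimes>\<^bsub>K\<^esub> \<phi> a \<otimes>\<^bsub>K\<^esub> (\<phi> b \<otimes>\<^bsub>K\<^esub> \<phi> b) =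
        \<phi> w \<otimes>\<^bsub>K\<^esub> (\<phi> a \<otimes>\<^bsub>K\<^esub> \<phi> a \<otimes>\<^bsub>K\<^esub> (\<phi> a \<otimes>\<^bsub>K\<^esub> \<phi> a)) \<oplus>\<^bsub>K\<^esub>
        \<phi> x \<otimes>\<^bsub>K\<^esub> (\<phi> a \<otimes>\<^bsub>K\<^esub> \<phi> a \<otimes>\<^bsub>K\<^esub> (\<phi> a \<otimes>\<^bsub>K\<^esub> \<phi> b)) \<oplus>\<^bsub>K\<^esub>
        \<phi> y \<otimes>\<^bsub>K\<^esub> (\<phi> a \<otimes>\<^bsub>K\<^esub> \<phi> b \<otimes>\<^bsub>K\<^esub> (\<phi> b \<otimes>\<^bsub>K\<^esub> \<phi> b)) \<oplus>\<^bsub>K\<^esub>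
        \<phi> z \<otimes>\<^bsub>K\<^esub> (\<phi> b \<otimes>\<^bsub>K\<^esub> \<phi> b \<otimes>\<^bsub>K\<^esub> (\<phi> b \<otimes>\<^bsub>K\<^esub> \<phi> b))"
        using arg_cong[OF eq, of \<phi>] ab(1,2) wc by simp
    qed (use ab wc in simp_all)
    with wc show ?thesis unfolding A_def by blast
  qed
  have "prufer_domain K D"
  proof (rule K.prufer_domainI[OF D])
    fix x assume "x \<in> carrier K"
    from frac[OF this] show "\<exists>a\<in>D. \<exists>b\<in>D - {\<zero>\<^bsub>K\<^esub>}. x = a \<otimes>\<^bsub>K\<^esub> inv\<^bsub>K\<^esub> b"
      using AD nz unfolding A_def by blast
  next
    fix a b assume ab: "a \<in> D" "b \<in> D" "a \<noteq> \<zero>\<^bsub>K\<^esub>"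
    show "\<exists>q\<in>carrier K. \<exists>s\<in>carrier K. q \<otimes>\<^bsub>K\<^esub> a \<oplus>\<^bsub>K\<^esub> s \<otimes>\<^bsub>K\<^esub> b = \<one>\<^bsub>K\<^esub> \<and>
        q \<otimes>\<^bsub>K\<^esub> a \<in> D \<and> q \<otimes>\<^bsub>K\<^esub> b \<in> D \<and> s \<otimes>\<^bsub>K\<^esub> a \<in> D \<and> s \<otimes>\<^bsub>K\<^esub> b \<in> D"
    proof (cases "b = \<zero>\<^bsub>K\<^esub>")
      case True
      have a: "a \<in> carrier K" using ab DD(1) by auto
      then have "inv\<^bsub>K\<^esub> a \<in> carrier K" "inv\<^bsub>K\<^esub> a \<otimes>\<^bsub>K\<^esub> a = \<one>\<^bsub>K\<^esub>"
        using ab(3) by (simp_all add: K.field_Units)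
      then show ?thesis
        using True a DD(2,3)
        by (intro bexI[of _ "inv\<^bsub>K\<^esub> a"] bexI[of _ "\<zero>\<^bsub>K\<^esub>"]) auto
    next
      case False
      have c: "a \<in> carrier K" "b \<in> carrier K" using ab DD(1) by auto
      have ib: "inv\<^bsub>K\<^esub> b \<in> carrier K" "inv\<^bsub>K\<^esub> b \<otimes>\<^bsub>K\<^esub> b = \<one>\<^bsub>K\<^esub>"
        using c(2) False by (simp_all add: K.field_Units)
      then have "inv\<^bsub>K\<^esub> b \<noteq> \<zero>\<^bsub>K\<^esub>" using c(2) by auto
      define u where "u = a \<otimes>\<^bsub>K\<^esub> inv\<^bsub>K\<^esub> b"
      have u: "u \<in> carrier K" "u \<noteq> \<zero>\<^bsub>K\<^esub>"
        using c ib ab(3) \<open>inv\<^bsub>K\<^esub> b \<noteq> \<zero>\<^bsub>K\<^esub>\<close> by (simp_all add: u_def K.integral_iff)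
      from unit_quartic[OF u] obtain w x y z where
        "w \<in> A" "x \<in> A" "y \<in> A" "z \<in> A"
        "u \<otimes>\<^bsub>K\<^esub> u = w \<otimes>\<^bsub>K\<^esub> (u \<otimes>\<^bsub>K\<^esub> u \<otimes>\<^bsub>K\<^esub> u \<otimes>\<^bsub>K\<^esub> u) \<oplus>\<^bsub>K\<^esub> x \<otimes>\<^bsub>K\<^esub> (u \<otimes>\<^bsub>K\<^esub> u \<otimes>\<^bsub>K\<^esub> u) \<oplus>\<^bsub>K\<^esub>
          y \<otimes>\<^bsub>K\<^esub> u \<oplus>\<^bsub>K\<^esub> z"
        by blast
      with AD obtain p q where pq: "p \<in> D" "q \<in> D" "p \<otimes>\<^bsub>K\<^esub> u \<in> D" "q \<otimes>\<^bsub>K\<^esub> u \<in> D"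
        "p \<otimes>\<^bsub>K\<^esub> u \<ominus>\<^bsub>K\<^esub> q = \<one>\<^bsub>K\<^esub>"
        using K.quartic_unit_coefficient[OF D closed u(1), of w x y z] by blast
      have pc: "p \<in> carrier K" "q \<in> carrier K" using pq DD(1) by auto
      have mid: "t \<otimes>\<^bsub>K\<^esub> inv\<^bsub>K\<^esub> b \<otimes>\<^bsub>K\<^esub> a = t \<otimes>\<^bsub>K\<^esub> u" "t \<otimes>\<^bsub>K\<^esub> inv\<^bsub>K\<^esub> b \<otimes>\<^bsub>K\<^esub> b = t"
        if "t \<in> carrier K" for t
        using that c ib by (simp_all add: u_def K.m_assoc K.m_comm[OF ib(1) c(1)])
      have eqs: "p \<otimes>\<^bsub>K\<^esub> inv\<^bsub>K\<^esub> b \<otimes>\<^bsub>K\<^esub> a = p \<otimes>\<^bsub>K\<^esub> u" "p \<otimes>\<^bsub>K\<^esub> inv\<^bsub>K\<^esub> b \<otimes>\<^bsub>K\<^esub> b = p"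
        "(\<ominus>\<^bsub>K\<^esub> q) \<otimes>\<^bsub>K\<^esub> inv\<^bsub>K\<^esub> b \<otimes>\<^bsub>K\<^esub> a = \<ominus>\<^bsub>K\<^esub> (q \<otimes>\<^bsub>K\<^esub> u)" "(\<ominus>\<^bsub>K\<^esub> q) \<otimes>\<^bsub>K\<^esub> inv\<^bsub>K\<^esub> b \<otimes>\<^bsub>K\<^esub> b = \<ominus>\<^bsub>K\<^esub> q"
        using mid[of p] mid[of "\<ominus>\<^bsub>K\<^esub> q"] pc u(1) by (simp_all add: K.l_minus)
      \<comment> \<open>Both \<open>p\<close> and \<open>q\<close> multiply \<open>1\<close> and \<open>u = a/b\<close> into \<open>D\<close>, so \<open>p/b\<close> and \<open>-q/b\<close> multiply
        \<open>b\<close> and \<open>a\<close> into \<open>D\<close>.\<close>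
      show ?thesis
      proof (intro bexI conjI)
        show "p \<otimes>\<^bsub>K\<^esub> inv\<^bsub>K\<^esub> b \<otimes>\<^bsub>K\<^esub> a \<oplus>\<^bsub>K\<^esub> (\<ominus>\<^bsub>K\<^esub> q) \<otimes>\<^bsub>K\<^esub> inv\<^bsub>K\<^esub> b \<otimes>\<^bsub>K\<^esub> b = \<one>\<^bsub>K\<^esub>"
          unfolding eqs using pq(5) by (simp add: a_minus_def)
      qed (use pq pc ib DD(5) eqs in simp_all)
    qed
  qed
  then show ?thesis by (simp add: D_def A_def)
qed

end
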